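(* Let $p$ be a prime and let $R$ be a finite ring such that the additive quotient group $R/Z(R)$ is isomorphic, as a group, to $\mathbb{Z}_p \times \mathbb{Z}_p$. Then $|\operatorname{Cent}(R)| = p + 2$.
   Context: Rings are associative and not assumed to have a unity. For $r \in R$, the centralizer of $r$ is the subring $C(r) = \{s \in R : rs = sr\}$, and $\operatorname{Cent}(R) = \{C(r) : r \in R\}$ is the set of all distinct centralizers. $Z(R) = \{s \in R : rs = sr \text{ for all } r \in R\}$ is the center. $R/Z(R)$ denotes the quotient of additive groups, and $\cong$ is isomorphism of additive groups. *)

theory Defs
  imports
    "HOL-Algebra.AbelCoset"
    "HOL-Algebra.Elementary_Groups"
    "HOL-Computational_Algebra.Primes"
begin

text \<open>
  The library locale \<open>ring\<close> includes a multiplicative unit. Here only an associative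
  multiplication distributing over the addition is required. The record type is still the library's;
  its field \<open>one\<close> is left unconstrained and plays no role.
\<close>

locale nonunital_ring = abelian_group R for R (structure) +
  assumes mult_closed [intro, simp]:
      "\<lbrakk>x \<in> carrier R; y \<in> carrier R\<rbrakk> \<Longrightarrow> x \<otimes> y \<in> carrier R"
    and mult_assoc:
      "\<lbrakk>x \<in> carrier R; y \<in> carrier R; z \<in> carrier R\<rbrakk> \<Longrightarrow> (x \<otimes> y) \<otimes> z = x \<otimes> (y \<otimes> z)"
    and distrib_right:
      "\<lbrakk>x \<in> carrier R; y \<in> carrier R; z \<in> carrier R\<rbrakk> \<Longrightarrow> (x \<oplus> y) \<otimes> z = x \<otimes> z \<oplus> y \<otimes> z"
    and distrib_left:
      "\<lbrakk>x \<in> carrier R; y \<in> carrier R; z \<in> carrier R\<rbrakk> \<Longrightarrow> z \<otimes> (x \<oplus> y) = z \<otimes> x \<oplus> z \<otimes> y"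

lemma (in ring) is_nonunital_ring: "nonunital_ring R"
  by unfold_locales (auto simp: m_assoc l_distr r_distr)

definition centralizer :: "('a, 'm) ring_scheme \<Rightarrow> 'a \<Rightarrow> 'a set"
  where "centralizer R r = {s \<in> carrier R. r \<otimes>\<^bsub>R\<^esub> s = s \<otimes>\<^bsub>R\<^esub> r}"

definition Cent :: "('a, 'm) ring_scheme \<Rightarrow> 'a set set"
  where "Cent R = {centralizer R r | r. r \<in> carrier R}"

definition ring_center :: "('a, 'm) ring_scheme \<Rightarrow> 'a set"
  where "ring_center R = {s \<in> carrier R. \<forall>r \<in> carrier R. r \<otimes>\<^bsub>R\<^esub> s = s \<otimes>\<^bsub>R\<^esub> r}"

context nonunital_ring
begin

lemma mult_zero_left: "x \<in> carrier R \<Longrightarrow> \<zero> \<otimes> x = \<zero>"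
  by (metis distrib_right mult_closed add.l_cancel_one' l_zero zero_closed)

lemma mult_zero_right: "x \<in> carrier R \<Longrightarrow> x \<otimes> \<zero> = \<zero>"
  by (metis distrib_left mult_closed add.l_cancel_one' l_zero zero_closed)

lemma mult_minus_left:
  assumes "x \<in> carrier R" "y \<in> carrier R"
  shows "(\<ominus> x) \<otimes> y = \<ominus> (x \<otimes> y)"
  by (metis assms a_inv_closed distrib_right l_neg minus_equality mult_closed mult_zero_left)

lemma mult_minus_right:
  assumes "x \<in> carrier R" "y \<in> carrier R"
  shows "x \<otimes> (\<ominus> y) = \<ominus> (x \<otimes> y)"
  by (metis assms a_inv_closed distrib_left l_neg minus_equality mult_closed mult_zero_right)

lemma abelian_subgroup_center: "abelian_subgroup (ring_center R) R"
proof (rule abelian_subgroupI3)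
  show "additive_subgroup (ring_center R) R"
  proof (rule additive_subgroup.intro, rule add.subgroupI)
    show "ring_center R \<subseteq> carrier R" "ring_center R \<noteq> {}"
      using mult_zero_left mult_zero_right by (auto simp: ring_center_def)
  next
    fix a assume "a \<in> ring_center R"
    then show "\<ominus> a \<in> ring_center R"
      by (auto simp: ring_center_def mult_minus_left mult_minus_right)
  next
    fix a b assume "a \<in> ring_center R" "b \<in> ring_center R"
    then show "a \<oplus> b \<in> ring_center R"
      by (auto simp: ring_center_def distrib_left distrib_right)
  qed
qed (rule abelian_group_axioms)

end

end

theory Submission
  imports Defs
begin

text \<open>
  By hypothesis \<open>R/Z(R)\<close> has order \<open>p\<^sup>2\<close>, so \<open>|R| = p\<^sup>2 |Z(R)|\<close>. The centralizer of a noncentral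
  \<open>r\<close> is an additive subgroup that contains \<open>Z(R)\<close> properly, because it contains \<open>r\<close>, and that is
  not all of \<open>R\<close>, because \<open>r\<close> is not central. As the only factorization of \<open>p\<^sup>2\<close> into factors
  greater than \<open>1\<close> is \<open>p \<cdot> p\<close>, Lagrange's theorem leaves one possible order for a subgroup strictly
  between \<open>Z(R)\<close> and \<open>R\<close>, namely \<open>p |Z(R)|\<close> (\<open>card_strictly_intermediate_subgroup\<close>).

  If two such centralizers share a noncentral element, their intersection is again strictly
  between \<open>Z(R)\<close> and \<open>R\<close>, so it has the same order as both, and they coincide
  (\<open>noncentral_centralizers_eq\<close>). Hence the sets \<open>C(r) - Z(R)\<close>, for \<open>r\<close> noncentral, partition
  \<open>R - Z(R)\<close> into blocks of size \<open>(p - 1) |Z(R)|\<close>. The whole has size \<open>(p\<^sup>2 - 1) |Z(R)|\<close>, so there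
  are \<open>p + 1\<close> blocks (\<open>card_noncentral_centralizers\<close>). The one further centralizer is \<open>R\<close> itself,
  the centralizer of every central element.
\<close>

lemma (in group) card_subgroup_dvd_card_subgroup:
  assumes "subgroup K G" "subgroup H G" "K \<subseteq> H"
  shows "card K dvd card H"
proof -
  interpret H: group "G\<lparr>carrier := H\<rparr>"
    using assms(2) by (rule subgroup.subgroup_is_group) (rule group_axioms)
  have "subgroup K (G\<lparr>carrier := H\<rparr>)"
    using assms by (simp add: subgroup_incl)
  then have "card (rcosets\<^bsub>G\<lparr>carrier := H\<rparr>\<^esub> K) * card K = card H"
    using H.lagrange by (simp add: order_def)
  then show ?thesis
    by (metis dvd_triv_right)
qed

lemma (in group) card_strictly_intermediate_subgroup:
  fixes p :: nat
  assumes "prime p" "finite (carrier G)"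
    and "subgroup K G" "order G = p\<^sup>2 * card K"
    and "subgroup H G" "K \<subset> H" "H \<subset> carrier G"
  shows "card H = p * card K"
proof -
  have fin: "finite H"
    using assms(2,7) finite_subset by blast
  have pos: "0 < card K"
    using assms(2,3) by (simp add: subgroup.finite_imp_card_positive)
  obtain a where a: "card H = card K * a"
    using card_subgroup_dvd_card_subgroup[OF assms(3,5)] assms(6) by auto
  obtain b where b: "order G = card H * b"
    using card_subgroup_dvd_card_subgroup[OF assms(5) subgroup_self] assms(7)
    by (auto simp: order_def)
  have ab: "a * b = p\<^sup>2"
    using a b assms(4) pos by (simp add: mult.commute mult.left_commute)
  have "a \<noteq> 1"
    using a psubset_card_mono[OF fin assms(6)] by auto
  moreover have "b \<noteq> 1"
    using b psubset_card_mono[OF assms(2,7)] by (auto simp: order_def)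
  moreover obtain i where "i \<le> 2" "a = p ^ i"
    using ab divides_primepow_nat[OF assms(1)] by (metis dvd_triv_left)
  moreover have "i \<noteq> 2"
    using ab \<open>a = p ^ i\<close> \<open>b \<noteq> 1\<close> prime_gt_0_nat[OF assms(1)] by auto
  moreover have "i \<noteq> 0"
    using \<open>a = p ^ i\<close> \<open>a \<noteq> 1\<close> by (metis power_0)
  ultimately have "i = 1"
    by linarith
  with a \<open>a = p ^ i\<close> show ?thesis
    by (simp only: power_one_right mult.commute)
qed

context nonunital_ring
begin

lemma subgroup_centralizer:
  assumes "r \<in> carrier R"
  shows "subgroup (centralizer R r) (add_monoid R)"
proof (rule add.subgroupI)
  show "centralizer R r \<subseteq> carrier R" "centralizer R r \<noteq> {}"
    using assms mult_zero_left mult_zero_right by (auto simp: centralizer_def)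
next
  fix a assume "a \<in> centralizer R r"
  with assms show "\<ominus> a \<in> centralizer R r"
    by (auto simp: centralizer_def mult_minus_left mult_minus_right)
next
  fix a b assume "a \<in> centralizer R r" "b \<in> centralizer R r"
  with assms show "a \<oplus> b \<in> centralizer R r"
    by (auto simp: centralizer_def distrib_left distrib_right)
qed

lemma subgroup_center: "subgroup (ring_center R) (add_monoid R)"
  using abelian_subgroup_center
  by (simp add: abelian_subgroup_def additive_subgroup.a_subgroup)

lemma centralizer_subset: "centralizer R r \<subseteq> carrier R"
  by (auto simp: centralizer_def)

lemma center_subset_centralizer: "r \<in> carrier R \<Longrightarrow> ring_center R \<subseteq> centralizer R r"
  by (auto simp: centralizer_def ring_center_def)

lemma self_in_centralizer: "r \<in> carrier R \<Longrightarrow> r \<in> centralizer R r"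
  by (simp add: centralizer_def)

lemma centralizer_eq_carrier_iff:
  "r \<in> carrier R \<Longrightarrow> centralizer R r = carrier R \<longleftrightarrow> r \<in> ring_center R"
  by (force simp: centralizer_def ring_center_def)

lemma card_center_pos: "finite (carrier R) \<Longrightarrow> 0 < card (ring_center R)"
  using subgroup.finite_imp_card_positive[OF subgroup_center] by simp

context
  fixes p :: nat
  assumes prime: "prime p" and fin: "finite (carrier R)"
    and card_carrier: "card (carrier R) = p\<^sup>2 * card (ring_center R)"
begin

lemma card_intermediate_additive_subgroup:
  assumes "subgroup H (add_monoid R)" "ring_center R \<subset> H" "H \<subset> carrier R"
  shows "card H = p * card (ring_center R)"
  using add.card_strictly_intermediate_subgroup[OF prime _ subgroup_center _ assms(1,2)]
    assms(3) fin card_carrier by (simp add: order_def)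

lemma card_noncentral_centralizer:
  assumes "r \<in> carrier R - ring_center R"
  shows "card (centralizer R r) = p * card (ring_center R)"
proof (rule card_intermediate_additive_subgroup)
  show "subgroup (centralizer R r) (add_monoid R)"
    using assms by (simp add: subgroup_centralizer)
  show "ring_center R \<subset> centralizer R r"
    using assms center_subset_centralizer self_in_centralizer by blast
  show "centralizer R r \<subset> carrier R"
    using assms centralizer_subset centralizer_eq_carrier_iff by blast
qed

text \<open>
  A noncentral common element makes the intersection strictly larger than the center, and then
  there is only one order left for the intersection and for both centralizers.
\<close>

lemma noncentral_centralizers_eq:
  assumes r: "r \<in> carrier R - ring_center R" and s: "s \<in> carrier R - ring_center R"
    and t: "t \<in> centralizer R r \<inter> centralizer R s" "t \<notin> ring_center R"
  shows "centralizer R r = centralizer R s"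
proof -
  let ?I = "centralizer R r \<inter> centralizer R s"
  have "card ?I = p * card (ring_center R)"
  proof (rule card_intermediate_additive_subgroup)
    show "subgroup ?I (add_monoid R)"
      using r s by (simp add: add.subgroups_Inter_pair subgroup_centralizer)
    show "ring_center R \<subset> ?I"
      using r s t center_subset_centralizer by blast
    show "?I \<subset> carrier R"
      using r centralizer_subset centralizer_eq_carrier_iff by blast
  qed
  then have "card ?I = card (centralizer R r)" "card ?I = card (centralizer R s)"
    using r s by (simp_all add: card_noncentral_centralizer)
  moreover have "finite (centralizer R r)" "finite (centralizer R s)"
    using fin centralizer_subset finite_subset by blast+
  ultimately show ?thesis
    by (metis card_subset_eq inf_le1 inf_le2)
qed

lemma card_noncentral_centralizers:
  "card (centralizer R ` (carrier R - ring_center R)) = p + 1"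
proof -
  let ?Z = "ring_center R" and ?N = "carrier R - ring_center R"
  let ?block = "\<lambda>r. centralizer R r - ?Z"
  have Z: "?Z \<subseteq> carrier R"
    by (auto simp: ring_center_def)
  have finZ: "finite ?Z"
    using Z fin finite_subset by blast
  have Union: "\<Union> (?block ` ?N) = ?N"
    using centralizer_subset self_in_centralizer by blast
  have "(p - 1) * card ?Z * card (?block ` ?N) = card (\<Union> (?block ` ?N))"
  proof (rule card_partition)
    show "finite (?block ` ?N)" "finite (\<Union> (?block ` ?N))"
      using fin by (simp_all only: Union finite_imageI finite_Diff)
  next
    fix B assume "B \<in> ?block ` ?N"
    then show "card B = (p - 1) * card ?Z"
      using finZ center_subset_centralizer
      by (auto simp: card_Diff_subset card_noncentral_centralizer diff_mult_distrib)
  next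
    fix A B assume "A \<in> ?block ` ?N" "B \<in> ?block ` ?N" "A \<noteq> B"
    then show "A \<inter> B = {}"
      using noncentral_centralizers_eq by blast
  qed
  also have "\<dots> = (p\<^sup>2 - 1) * card ?Z"
    using Z finZ unfolding Union by (simp add: card_Diff_subset card_carrier diff_mult_distrib)
  also have "\<dots> = (p - 1) * card ?Z * (p + 1)"
    by (cases p) (simp_all add: power2_eq_square algebra_simps)
  finally have "(p - 1) * card ?Z * card (?block ` ?N) = (p - 1) * card ?Z * (p + 1)" .
  moreover have "(p - 1) * card ?Z \<noteq> 0"
    using prime_gt_1_nat[OF prime] card_center_pos[OF fin] by simp
  ultimately have "card (?block ` ?N) = p + 1"
    by (simp only: mult_cancel1 simp_thms)
  moreover have "?block ` ?N = (\<lambda>X. X - ?Z) ` centralizer R ` ?N"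
    by (simp add: image_image)
  \<comment> \<open>Removing the center loses nothing, since every centralizer contains it.\<close>
  moreover have "inj_on (\<lambda>X. X - ?Z) (centralizer R ` ?N)"
    by (rule inj_onI) (use center_subset_centralizer in blast)
  ultimately show ?thesis
    by (simp add: card_image)
qed

lemma card_Cent: "card (Cent R) = p + 2"
proof -
  let ?N = "carrier R - ring_center R"
  have "\<zero> \<in> ring_center R"
    using mult_zero_left mult_zero_right by (simp add: ring_center_def)
  then have "Cent R = insert (carrier R) (centralizer R ` ?N)"
    using centralizer_eq_carrier_iff by (auto simp: Cent_def)
  moreover have "carrier R \<notin> centralizer R ` ?N"
    using centralizer_eq_carrier_iff by blast
  ultimately show ?thesis
    using fin by (simp add: card_noncentral_centralizers)
qed

end

end

theorem theorem2p11:
  fixes R :: "('a, 'm) ring_scheme" and p :: nat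
  assumes "prime p"
    and "nonunital_ring R"
    and "finite (carrier R)"
    and "R A_Mod (ring_center R) \<cong> integer_mod_group p \<times>\<times> integer_mod_group p"
  shows "card (Cent R) = p + 2"
proof -
  interpret nonunital_ring R by fact
  have "card (carrier (integer_mod_group p)) = p"
    using prime_gt_0_nat[OF assms(1)] by (simp add: carrier_integer_mod_group)
  then have "card (carrier (R A_Mod (ring_center R))) = p\<^sup>2"
    using iso_same_card[OF assms(4)]
    by (simp add: DirProd_def card_cartesian_product power2_eq_square)
  then have "card (carrier R) = p\<^sup>2 * card (ring_center R)"
    using add.lagrange[OF subgroup_center]
    by (simp add: A_FactGroup_def FactGroup_def order_def)
  with assms(1,3) show ?thesis by (rule card_Cent)
qed

end
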